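(* Let $K=\mathbb{Q}(\sqrt{2},\sqrt{3})$. There are no non-trivial solutions (i.e. with $xyz\neq 0$) to $x^6+y^6=z^6$ with $x,y,z\in K$. *)

theory Defs
  imports Complex_Main "HOL-Algebra.Generated_Fields" "HOL-Algebra.Algebraic_Closure_Type"
begin

(* The subfield of the reals generated over the rationals by sqrt 2 and sqrt 3;
   ring_of_type_algebra is the type real viewed as a HOL-Algebra ring. *)
definition Q_sqrt2_sqrt3 :: "real set" where
  "Q_sqrt2_sqrt3 = generate_field ring_of_type_algebra (\<rat> \<union> {sqrt 2, sqrt 3})"

end

theory Submission
  imports Defs "HOL-Computational_Algebra.Nth_Powers"
begin

text \<open>
  Put \<open>k = Q(sqrt 3)\<close> and \<open>K = k(sqrt 2)\<close>, and normalise to \<open>x\<^sup>6 + y\<^sup>6 = 1\<close>. A solution gives the points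
  \<open>(1/x\<^sup>2, (y/x)\<^sup>3)\<close> and \<open>(1/y\<^sup>2, (x/y)\<^sup>3)\<close> on \<open>E: v\<^sup>2 = u\<^sup>3 - 1\<close> over \<open>K\<close>. Over \<open>k\<close> the only affine point of
  \<open>E\<close> is \<open>(1, 0)\<close>: the line through a point and its conjugate is rational, which reduces this to the
  rational points of \<open>v\<^sup>2 = u\<^sup>3 - 1\<close> and \<open>3 v\<^sup>2 = u\<^sup>3 - 1\<close>, found by infinite descent, and to a 3-adic
  obstruction. Likewise, the line through a \<open>K\<close>-point \<open>(u, v)\<close> of \<open>E\<close> and its conjugate over \<open>k\<close> is either
  vertical or passes through \<open>(1, 0)\<close>, in which case \<open>u - 1\<close> has norm 3. As \<open>x\<^sup>2\<close> and \<open>y\<^sup>2\<close> are positive in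
  every real embedding, the second case is impossible for both points, and also for just one of them.
  If both lines are vertical then, up to symmetry, \<open>x\<close> and \<open>b = y / sqrt 2\<close> lie in \<open>k\<close>, and
  \<open>(- 2 b\<^sup>2, x\<^sup>3)\<close> is a point over \<open>k\<close> on \<open>v\<^sup>2 = u\<^sup>3 + 1\<close> with \<open>u\<close> totally negative. The same line argument,
  now using the rational points of \<open>v\<^sup>2 = u\<^sup>3 + 1\<close> and \<open>3 v\<^sup>2 = u\<^sup>3 + 1\<close>, excludes it.
\<close>

section \<open>Rational points by infinite descent\<close>

lemma power4_eq_square_square: "x ^ 4 = (x\<^sup>2)\<^sup>2" for x :: "'a::monoid_mult"
  by (simp flip: power_mult)

text \<open>\<open>3 * m\<^sup>2\<close> is a power of 3, so coprimality puts all of it into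
  \<open>T\<close> once 3 does not divide \<open>S\<close>. The remaining factors are coprime with
  product \<open>f ^ 4\<close>, hence fourth powers.\<close>

lemma coprime_mult_eq_power4:
  fixes S T m f :: nat
  assumes m: "m = 1 \<or> m = 3" and cop: "coprime S T" and eq: "S * T = 3 * m\<^sup>2 * f ^ 4"
    and f: "f > 0" and S: "\<not> 3 dvd S"
  obtains g h where "S = g ^ 4" "T = 3 * m\<^sup>2 * h ^ 4" "f = g * h"
proof -
  have c3: "coprime S 3"
    using S prime_imp_coprime[of "3::nat" S] by (simp add: coprime_commute)
  have "coprime S (3 * m\<^sup>2)"
    using m c3 by auto
  moreover have "3 * m\<^sup>2 dvd S * T" unfolding eq by simp
  ultimately have "3 * m\<^sup>2 dvd T"
    by (metis coprime_commute coprime_dvd_mult_right_iff)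
  then obtain T' where T': "T = 3 * m\<^sup>2 * T'" by blast
  have m0: "m > 0" using m by auto
  have ST: "S * T' = f ^ 4"
    using eq m0 unfolding T' by simp
  have "coprime S T'" using cop unfolding T' by simp
  moreover have "is_nth_power 4 (S * T')" unfolding ST by simp
  moreover have "S > 0" "T' > 0" using ST f by (auto intro!: Nat.gr0I)
  ultimately have "is_nth_power 4 S" "is_nth_power 4 T'"
    using is_nth_power_mult_coprime_natD by blast+
  then obtain g h where gh: "S = g ^ 4" "T' = h ^ 4"
    by (auto elim!: is_nth_powerE)
  have "(g * h) ^ 4 = f ^ 4" using ST gh by (simp add: power_mult_distrib)
  hence "f = g * h" using power_eq_iff_eq_base[of 4 "g*h" f] by simp
  thus ?thesis using gh T' that by blast
qed

text \<open>
  The quartics are 2-coverings of the curves \<open>y\<^sup>2 = x\<^sup>3 - m\<^sup>3\<close>. Completing the square and factoring twice,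
  once for each of the two 2-isogenies, turns a solution \<open>(a, e, c)\<close> into a solution \<open>(s, t, g)\<close>
  with \<open>e = 2 g s t\<close>.
\<close>
lemma quartic_no_solution:
  fixes a e c m :: nat
  assumes m: "m = 1 \<or> m = 3"
  shows "e > 0 \<Longrightarrow> coprime a e \<Longrightarrow> \<not> 3 dvd a \<Longrightarrow>
    a ^ 4 + 3 * m * a\<^sup>2 * e\<^sup>2 + 3 * m\<^sup>2 * e ^ 4 \<noteq> c\<^sup>2"
proof (induction e arbitrary: a c rule: less_induct)
  case (less e)
  note e = less.prems(1) and cop = less.prems(2) and a3 = less.prems(3)
  show ?case
  proof
    assume eq: "a ^ 4 + 3 * m * a\<^sup>2 * e\<^sup>2 + 3 * m\<^sup>2 * e ^ 4 = c\<^sup>2"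
    have m0: "m > 0" "odd m" using m by auto
    have a0: "a > 0" using a3 by (auto intro: Nat.gr0I)
    have sq8: "x\<^sup>2 mod 8 = (if even x then (if 4 dvd x then 0 else 4) else 1)" for x :: nat
    proof -
      have "x mod 8 \<in> {0,1,2,3,4,5,6,7}" by auto
      moreover have "x\<^sup>2 mod 8 = (x mod 8)\<^sup>2 mod 8" by (simp add: power_mod)
      moreover have "even x \<longleftrightarrow> even (x mod 8)" "4 dvd x \<longleftrightarrow> 4 dvd (x mod 8)"
        by presburger+
      ultimately show ?thesis by auto
    qed
    \<comment> \<open>For odd \<open>e\<close> the left side is 3, 5 or 7 modulo 8, and no square
      is.\<close>
    have "even e"
    proof (rule ccontr)
      assume "odd e"
      have e2: "e\<^sup>2 mod 8 = 1" unfolding sq8[of e] using \<open>odd e\<close> by simp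
      have e4: "(e\<^sup>2)\<^sup>2 mod 8 = 1" unfolding sq8[of "e\<^sup>2"] using \<open>odd e\<close> by simp
      have "(a ^ 4 + 3 * m * a\<^sup>2 * e\<^sup>2 + 3 * m\<^sup>2 * e ^ 4) mod 8
          = ((a\<^sup>2 mod 8)\<^sup>2 + 3 * m * (a\<^sup>2 mod 8) * (e\<^sup>2 mod 8) + 3 * m\<^sup>2 * ((e\<^sup>2)\<^sup>2 mod 8)) mod 8"
        unfolding power4_eq_square_square by (intro mod_add_cong mod_mult_cong refl) (simp_all add: power_mod)
      also have "\<dots> \<in> {3, 5, 7}"
        using m unfolding e2 e4 sq8[of a] by auto
      finally have "c\<^sup>2 mod 8 \<in> {3, 5, 7}" unfolding eq .
      thus False using sq8[of c] by (auto split: if_splits)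
    qed
    then obtain f where f: "e = 2 * f" by blast
    have f0: "f > 0" using e f by simp
    have aodd: "odd a" using cop f by (metis coprime_common_divisor dvd_triv_left odd_one)
    \<comment> \<open>Completing the square gives
      \<open>c\<^sup>2 - M\<^sup>2 = 12 * m\<^sup>2 * f ^ 4\<close>; \<open>S\<close> and
      \<open>T\<close> below are \<open>(c - M) / 2\<close> and \<open>(c + M) / 2\<close>.\<close>
    define M where "M = a\<^sup>2 + 6 * m * f\<^sup>2"
    have cM: "c\<^sup>2 = M\<^sup>2 + 12 * m\<^sup>2 * f ^ 4"
      unfolding eq[symmetric] M_def f by (simp add: power2_eq_square power4_eq_xxxx algebra_simps)
    have "M < c"
    proof (rule power_less_imp_less_base)
      show "M\<^sup>2 < c\<^sup>2" using cM m0 f0 by simp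
    qed simp
    moreover have "odd M" using aodd by (simp add: M_def)
    moreover have "even (c\<^sup>2) \<longleftrightarrow> even (M\<^sup>2)" unfolding cM by simp
    ultimately have "even (c - M)" "c - M > 0" by auto
    then obtain S where S: "c = M + 2 * S" "S > 0"
      by (metis add_diff_inverse_nat evenE \<open>M < c\<close> less_imp_le_nat linorder_not_le nat_0_less_mult_iff)
    define T where "T = M + S"
    have ST: "S * T = 3 * m\<^sup>2 * f ^ 4"
    proof -
      have "4 * (S * T) = 4 * (3 * m\<^sup>2 * f ^ 4)"
        using cM unfolding S T_def by (simp add: power2_eq_square algebra_simps)
      thus ?thesis by linarith
    qed
    have caf: "coprime a f" using cop f by simp
    have p3: "p = 3 \<or> p dvd x" if "Factorial_Ring.prime p" "p dvd 3 * m\<^sup>2 * x ^ 4" for p x :: nat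
    proof -
      have "p dvd 3 \<or> p dvd m \<or> p dvd x"
        using that by (auto simp: prime_dvd_mult_iff prime_dvd_power_iff)
      thus ?thesis using m that(1) by (auto simp: primes_dvd_imp_eq)
    qed
    have copST: "coprime S T"
    proof (rule ccontr)
      assume "\<not> coprime S T"
      then obtain p where p: "Factorial_Ring.prime p" "p dvd S" "p dvd T"
        using prime_factor_nat[of "gcd S T"] by (auto simp: coprime_iff_gcd_eq_1)
      hence pM: "p dvd M" unfolding T_def by (simp add: dvd_add_left_iff)
      have "p dvd S * T" using p by simp
      hence "p = 3 \<or> p dvd f" unfolding ST using p3[OF p(1)] by blast
      hence "p dvd 6 * m * f\<^sup>2" by (auto simp: power2_eq_square)
      hence "p dvd a\<^sup>2" using pM unfolding M_def by (simp add: dvd_add_left_iff)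
      hence pa: "p dvd a" using p(1) prime_dvd_power by blast
      from \<open>p = 3 \<or> p dvd f\<close> show False
        using pa a3 caf p(1) by (metis coprime_common_divisor nat_dvd_1_iff_1 not_prime_1)
    qed
    have "\<not> (3 dvd S \<and> 3 dvd T)"
      using copST coprime_common_divisor[of S T 3] by auto
    \<comment> \<open>Otherwise \<open>S = g ^ 4\<close> and 3 divides \<open>T = M + S\<close>, so
      3 divides \<open>a\<^sup>2 + g ^ 4\<close>. As -1 is not a square modulo 3, this forces 3 to
      divide \<open>a\<close>.\<close>
    moreover have "3 dvd S"
    proof (rule ccontr)
      assume "\<not> 3 dvd S"
      from coprime_mult_eq_power4[OF m copST ST f0 this]
      obtain g h where gh: "S = g ^ 4" "T = 3 * m\<^sup>2 * h ^ 4" "f = g * h" .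
      have "3 dvd a\<^sup>2 + (g\<^sup>2)\<^sup>2 + 6 * m * f\<^sup>2"
        using gh unfolding T_def M_def by (metis add.commute add.left_commute dvd_triv_left mult.assoc power4_eq_square_square)
      moreover have "3 dvd 6 * m * f\<^sup>2" by (simp add: dvd_mult2)
      ultimately have "3 dvd a\<^sup>2 + (g\<^sup>2)\<^sup>2" using dvd_add_left_iff by blast
      hence *: "(a\<^sup>2 + (g\<^sup>2)\<^sup>2) mod 3 = 0" by (simp only: dvd_eq_mod_eq_0)
      have sq3: "x\<^sup>2 mod 3 = (if 3 dvd x then 0 else 1)" for x :: nat
      proof -
        have "x mod 3 \<in> {0,1,2}" by auto
        moreover have "x\<^sup>2 mod 3 = (x mod 3)\<^sup>2 mod 3" by (simp add: power_mod)
        moreover have "3 dvd x \<longleftrightarrow> x mod 3 = 0" by presburger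
        ultimately show ?thesis by auto
      qed
      from * show False
        using a3 sq3[of a] sq3[of "g\<^sup>2"] mod_add_eq[of "a\<^sup>2" 3 "(g\<^sup>2)\<^sup>2"] by (auto split: if_splits)
    qed
    ultimately have T3: "\<not> 3 dvd T" by blast
    have "coprime T S" "T * S = 3 * m\<^sup>2 * f ^ 4" using copST ST by (simp_all add: coprime_commute mult.commute)
    from coprime_mult_eq_power4[OF m this f0 T3]
    obtain g h where gh: "T = g ^ 4" "S = 3 * m\<^sup>2 * h ^ 4" "f = g * h" .
    have g0: "g > 0" and h0: "h > 0" using f0 gh(3) by auto
    have geq: "g ^ 4 = a\<^sup>2 + 6 * m * g\<^sup>2 * h\<^sup>2 + 3 * m\<^sup>2 * h ^ 4"
      using gh unfolding T_def M_def by (simp add: power_mult_distrib algebra_simps)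
    \<comment> \<open>The second completion of the square uses
      \<open>N = g\<^sup>2 - 3 * m * h\<^sup>2\<close>, which must be positive. Afterwards
      \<open>V\<close> and \<open>U\<close> are \<open>(N - a) / 2\<close> and
      \<open>(N + a) / 2\<close>.\<close>
    have "3 * m * h\<^sup>2 < g\<^sup>2"
    proof (rule ccontr)
      assume "\<not> ?thesis"
      hence "g\<^sup>2 * g\<^sup>2 \<le> g\<^sup>2 * (3 * m * h\<^sup>2)" by (intro mult_le_mono2) simp
      also have "\<dots> \<le> 6 * m * g\<^sup>2 * h\<^sup>2" by simp
      also have "\<dots> < g ^ 4" unfolding geq using a0 by simp
      finally show False by (simp add: power4_eq_xxxx power2_eq_square)
    qed
    then obtain N where N: "g\<^sup>2 = N + 3 * m * h\<^sup>2" "N > 0"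
      by (metis add.commute less_imp_add_positive)
    have Na: "N\<^sup>2 = a\<^sup>2 + 12 * m\<^sup>2 * h ^ 4"
    proof -
      have "(N + 3 * m * h\<^sup>2)\<^sup>2 = a\<^sup>2 + 6 * m * (N + 3 * m * h\<^sup>2) * h\<^sup>2 + 3 * m\<^sup>2 * h ^ 4"
        using geq unfolding power4_eq_square_square[of g] N by simp
      thus ?thesis by (simp add: power2_eq_square power4_eq_xxxx algebra_simps)
    qed
    have "a < N"
    proof (rule power_less_imp_less_base)
      show "a\<^sup>2 < N\<^sup>2" using Na m0 h0 by simp
    qed simp
    have "even (N\<^sup>2) \<longleftrightarrow> even (a\<^sup>2)" unfolding Na by simp
    hence "odd N" using aodd by simp
    hence "even (N - a)" using aodd by simp
    then obtain V where V: "N = a + 2 * V" "V > 0"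
      by (metis add_diff_inverse_nat evenE \<open>a < N\<close> not_less_iff_gr_or_eq zero_less_diff nat_0_less_mult_iff)
    define U where "U = V + a"
    have VU: "V * U = 3 * m\<^sup>2 * h ^ 4"
    proof -
      have "4 * (V * U) = 4 * (3 * m\<^sup>2 * h ^ 4)"
        using Na unfolding V U_def by (simp add: power2_eq_square algebra_simps)
      thus ?thesis by linarith
    qed
    have cah: "coprime a h" using caf gh by simp
    have copVU: "coprime V U"
    proof (rule ccontr)
      assume "\<not> coprime V U"
      then obtain p where p: "Factorial_Ring.prime p" "p dvd V" "p dvd U"
        using prime_factor_nat[of "gcd V U"] by (auto simp: coprime_iff_gcd_eq_1)
      hence pa: "p dvd a" unfolding U_def by (simp add: dvd_add_right_iff)
      have "p dvd V * U" using p by simp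
      hence "p = 3 \<or> p dvd h" unfolding VU using p3[OF p(1)] by blast
      thus False
        using pa a3 cah p(1) by (metis coprime_common_divisor nat_dvd_1_iff_1 not_prime_1)
    qed
    have "\<not> (3 dvd V \<and> 3 dvd U)"
      using copVU coprime_common_divisor[of V U 3] by auto
    then consider "\<not> 3 dvd V" | "\<not> 3 dvd U" by blast
    \<comment> \<open>Only the sum and the product of \<open>V\<close> and \<open>U\<close> matter,
      so either of them may be the pure fourth power.\<close>
    then obtain s t where st: "V + U = s ^ 4 + 3 * m\<^sup>2 * t ^ 4" "h = s * t"
      "coprime (s ^ 4) (3 * m\<^sup>2 * t ^ 4)"
    proof cases
      case 1
      from coprime_mult_eq_power4[OF m copVU VU h0 1] show ?thesis
        using that copVU by metis
    next
      case 2
      have "coprime U V" "U * V = 3 * m\<^sup>2 * h ^ 4" using copVU VU by (simp_all add: coprime_commute mult.commute)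
      from coprime_mult_eq_power4[OF m this h0 2] this(1) show ?thesis
        using that by (metis add.commute)
    qed
    \<comment> \<open>This is \<open>g\<^sup>2 = N + 3 * m * h\<^sup>2\<close> with
      \<open>N = V + U\<close> and \<open>h = s * t\<close>: the original quartic at a smaller
      \<open>t\<close>.\<close>
    have geq': "s ^ 4 + 3 * m * s\<^sup>2 * t\<^sup>2 + 3 * m\<^sup>2 * t ^ 4 = g\<^sup>2"
      using N(1) st(1,2) unfolding V U_def by (simp add: power_mult_distrib algebra_simps)
    have t0: "t > 0" using h0 st(2) by auto
    have "t \<le> h" using st(2) h0 by auto
    also have "h \<le> f" using gh(3) f0 by auto
    also have "f < e" using f f0 by simp
    finally have "t < e" .
    moreover have "coprime s t" using st(3) t0 by simp
    moreover have "\<not> 3 dvd s"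
    proof
      assume "3 dvd s"
      hence "3 dvd s ^ 4" by (simp add: power4_eq_xxxx)
      thus False using st(3) coprime_common_divisor[of "s ^ 4" "3 * m\<^sup>2 * t ^ 4" 3] by (simp add: mult.assoc)
    qed
    ultimately show False using less.IH[OF _ t0] geq' by blast
  qed
qed

section \<open>Squares of rational numbers\<close>

lemma rational_square_Ints:
  fixes r :: real
  assumes "r \<in> \<rat>" "r\<^sup>2 \<in> \<int>"
  shows "r \<in> \<int>"
proof -
  have "algebraic_int (sqrt (r\<^sup>2))"
    using assms(2) by (intro algebraic_int_sqrt int_imp_algebraic_int)
  hence "algebraic_int r" by simp
  thus ?thesis using assms(1) by (rule rational_algebraic_int_is_int)
qed

lemma rational_square_neq:
  fixes r :: real
  assumes "r \<in> \<rat>"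
  shows "r\<^sup>2 \<noteq> 2" "r\<^sup>2 \<noteq> 3" "r\<^sup>2 \<noteq> 6"
proof -
  have "r\<^sup>2 \<noteq> of_int d" if d: "d \<in> {2, 3, 6}" for d
  proof
    assume eq: "r\<^sup>2 = of_int d"
    hence "r \<in> \<int>" using rational_square_Ints[OF assms] by simp
    then obtain k where "r = of_int k" by (elim Ints_cases)
    hence k: "k\<^sup>2 = d" using eq by (metis of_int_eq_iff of_int_power)
    hence "\<bar>k\<bar>\<^sup>2 < 3\<^sup>2" using d by auto
    hence "\<bar>k\<bar> < 3" by (rule power_less_imp_less_base) simp
    hence "k \<in> {-2, -1, 0, 1, 2}" by auto
    thus False using k d by auto
  qed
  from this[of 2] this[of 3] this[of 6] show "r\<^sup>2 \<noteq> 2" "r\<^sup>2 \<noteq> 3" "r\<^sup>2 \<noteq> 6" by simp_all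
qed

text \<open>The factors \<open>u\<close>, \<open>v\<close> and the quadratic form are pairwise
  coprime with square product, so each is a square; \<open>u = a\<^sup>2\<close> and
  \<open>v = e\<^sup>2\<close> turn the quadratic form into the quartic of
  \<open>quartic_no_solution\<close>.\<close>

lemma coprime_quartic_no_solution:
  fixes u v m N :: nat
  assumes m: "m = 1 \<or> m = 3" and v: "v > 0" and cop: "coprime u v" and u3: "\<not> 3 dvd u"
  shows "u * v * (u\<^sup>2 + 3 * m * u * v + 3 * m\<^sup>2 * v\<^sup>2) \<noteq> N\<^sup>2"
proof
  define Q where "Q = u\<^sup>2 + 3 * m * u * v + 3 * m\<^sup>2 * v\<^sup>2"
  assume eq: "u * v * (u\<^sup>2 + 3 * m * u * v + 3 * m\<^sup>2 * v\<^sup>2) = N\<^sup>2"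
  have u0: "u > 0" using u3 by (auto intro: Nat.gr0I)
  have "coprime u 3"
    using u3 prime_imp_coprime[of "3::nat" u] by (simp add: coprime_commute)
  hence "coprime u (3 * m\<^sup>2 * v\<^sup>2)" using m cop by auto
  moreover have "Q = (u + 3 * m * v) * u + 3 * m\<^sup>2 * v\<^sup>2"
    by (simp add: Q_def algebra_simps power2_eq_square)
  ultimately have uQ: "coprime u Q"
    by (simp only: coprime_iff_gcd_eq_1 gcd_add_mult)
  have "Q = (3 * m * u + 3 * m\<^sup>2 * v) * v + u\<^sup>2"
    by (simp add: Q_def algebra_simps power2_eq_square)
  moreover have "coprime v (u\<^sup>2)" using cop by (simp add: coprime_commute)
  ultimately have vQ: "coprime v Q"
    by (simp only: coprime_iff_gcd_eq_1 gcd_add_mult)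
  have Q0: "Q > 0" using u0 by (simp add: Q_def)
  have "is_nth_power 2 (u * v * Q)" using eq unfolding Q_def by simp
  moreover have "coprime (u * v) Q" using uQ vQ by simp
  ultimately have "is_nth_power 2 (u * v)" "is_nth_power 2 Q"
    using is_nth_power_mult_coprime_natD[of "u*v" Q 2] u0 v Q0 by auto
  moreover from this(1) have "is_nth_power 2 u" "is_nth_power 2 v"
    using is_nth_power_mult_coprime_natD[of u v 2] u0 v cop by auto
  ultimately obtain a e c where sq: "u = a\<^sup>2" "v = e\<^sup>2" "Q = c\<^sup>2"
    unfolding is_nth_power_def by blast
  have "e > 0" using v sq by simp
  moreover have "coprime a e" using cop sq by simp
  moreover have "\<not> 3 dvd a" using u3 sq by (auto simp: power2_eq_square)
  ultimately have "a ^ 4 + 3 * m * a\<^sup>2 * e\<^sup>2 + 3 * m\<^sup>2 * e ^ 4 \<noteq> c\<^sup>2"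
    by (rule quartic_no_solution[OF m])
  thus False by (simp add: power4_eq_square_square Q_def flip: sq)
qed

lemma three_dvd_square_nat: "3 dvd x\<^sup>2 \<Longrightarrow> 3 dvd x" for x :: nat
  using prime_dvd_power[of "3::nat" x 2] by simp

text \<open>The form is \<open>q ^ 4 * w * (w\<^sup>2 + 3 * w + 3)\<close> at
  \<open>w = p / q\<close>. If 3 divides \<open>p\<close>, replacing \<open>w\<close> by
  \<open>3 / w\<close> (translation by the 2-torsion point at \<open>w = 0\<close>) gives the same
  form in \<open>q\<close> and \<open>p / 3\<close>, and 3 does not divide \<open>q\<close>.\<close>

lemma cubic_form_not_square:
  fixes p q N :: nat
  assumes p: "p > 0" and q: "q > 0" and cop: "coprime p q"
  shows "p * q * (p\<^sup>2 + 3 * p * q + 3 * q\<^sup>2) \<noteq> N\<^sup>2"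
proof
  assume eq: "p * q * (p\<^sup>2 + 3 * p * q + 3 * q\<^sup>2) = N\<^sup>2"
  show False
  proof (cases "3 dvd p")
    case False
    thus False using coprime_quartic_no_solution[of 1 q p N] q cop eq by simp
  next
    case True
    then obtain r where r: "p = 3 * r" by blast
    have q3: "\<not> 3 dvd q"
      using True cop coprime_common_divisor[of p q 3] by auto
    have eq9: "3 * (3 * (q * r * (q\<^sup>2 + 3 * q * r + 3 * r\<^sup>2))) = N\<^sup>2"
      using eq unfolding r by (simp add: power2_eq_square algebra_simps)
    hence "3 dvd N\<^sup>2" by (metis dvd_triv_left)
    then obtain M where M: "N = 3 * M" using three_dvd_square_nat by blast
    have "q * r * (q\<^sup>2 + 3 * q * r + 3 * r\<^sup>2) = M\<^sup>2"
      using eq9 unfolding M by (simp add: power2_eq_square)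
    moreover have "coprime q r" using cop r by (simp add: coprime_commute)
    ultimately show False
      using coprime_quartic_no_solution[of 1 r q M] q3 p r by simp
  qed
qed

text \<open>The counterpart for the twist \<open>3 * y\<^sup>2 = x ^ 3 - 1\<close>, and the source
  of the case \<open>m = 3\<close>: if 3 does not divide \<open>u\<close>, the extra factor 3 forces
  \<open>v = 3 * r\<close>, which turns the form with \<open>m = 1\<close> into the one with
  \<open>m = 3\<close>. The case where 3 divides \<open>p\<close> is again reduced by
  \<open>w\<close> to \<open>3 / w\<close>.\<close>

lemma three_cubic_form_not_square:
  fixes p q N :: nat
  assumes p: "p > 0" and q: "q > 0" and cop: "coprime p q"
  shows "3 * (p * q * (p\<^sup>2 + 3 * p * q + 3 * q\<^sup>2)) \<noteq> N\<^sup>2"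
proof
  assume eq: "3 * (p * q * (p\<^sup>2 + 3 * p * q + 3 * q\<^sup>2)) = N\<^sup>2"
  have *: False if uv: "v > 0" "coprime u v" "\<not> 3 dvd u"
    and eq: "3 * (u * v * (u\<^sup>2 + 3 * u * v + 3 * v\<^sup>2)) = N\<^sup>2" for u v N :: nat
  proof -
    have "3 dvd N\<^sup>2" unfolding eq[symmetric] by simp
    then obtain M where M: "N = 3 * M" using three_dvd_square_nat by blast
    have eqM: "u * v * (u\<^sup>2 + 3 * u * v + 3 * v\<^sup>2) = 3 * M\<^sup>2"
      using eq unfolding M by (simp add: power2_eq_square)
    hence "3 dvd u * v * (u\<^sup>2 + 3 * u * v + 3 * v\<^sup>2)" by simp
    moreover have "3 dvd u\<^sup>2 + 3 * u * v + 3 * v\<^sup>2 \<longleftrightarrow> 3 dvd u\<^sup>2"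
      by (simp add: add.assoc dvd_add_left_iff mult.assoc)
    ultimately have "3 dvd v"
      using uv(3) three_dvd_square_nat prime_dvd_mult_iff[of "3::nat"] by auto
    then obtain r where r: "v = 3 * r" by blast
    have "u * r * (u\<^sup>2 + 3 * 3 * u * r + 3 * 3\<^sup>2 * r\<^sup>2) = M\<^sup>2"
      using eqM unfolding r by (simp add: power2_eq_square algebra_simps)
    thus False
      using coprime_quartic_no_solution[of 3 r u M] uv r by simp
  qed
  show False
  proof (cases "3 dvd p")
    case False
    thus False using * q cop eq by blast
  next
    case True
    then obtain r where r: "p = 3 * r" by blast
    have q3: "\<not> 3 dvd q"
      using True cop coprime_common_divisor[of p q 3] by auto
    have eq9: "3 * (3\<^sup>2 * (q * r * (q\<^sup>2 + 3 * q * r + 3 * r\<^sup>2))) = N\<^sup>2"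
      using eq unfolding r by (simp add: power2_eq_square algebra_simps)
    hence "3 dvd N\<^sup>2" by (metis dvd_triv_left)
    then obtain M where M: "N = 3 * M" using three_dvd_square_nat by blast
    have "3 * (q * r * (q\<^sup>2 + 3 * q * r + 3 * r\<^sup>2)) = M\<^sup>2"
      using eq9 unfolding M by (simp add: power2_eq_square)
    moreover have "coprime q r" using cop r by (simp add: coprime_commute)
    ultimately show False using * q3 p r by simp
  qed
qed

text \<open>With the 2-torsion point moved to \<open>w = 0\<close>, positivity of
  \<open>w\<^sup>2 + 3 * w + 3\<close> makes \<open>w\<close> positive, and clearing denominators
  leads to the two forms above. The twist \<open>D = 3\<close> accounts for points over Q(sqrt 3)
  whose ordinate is a rational multiple of \<open>sqrt 3\<close>.\<close>

lemma cube_minus_one_rational: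
  fixes x y D :: real
  assumes xy: "x \<in> \<rat>" "y \<in> \<rat>" and D: "D = 1 \<or> D = 3" and eq: "D * y\<^sup>2 = x ^ 3 - 1"
  shows "x = 1"
proof (rule ccontr)
  assume "x \<noteq> 1"
  define w where "w = x - 1"
  have weq: "D * y\<^sup>2 = w * (w\<^sup>2 + 3 * w + 3)"
    unfolding eq w_def by (simp add: power2_eq_square power3_eq_cube algebra_simps)
  have "w\<^sup>2 + 3 * w + 3 = (w + 3/2)\<^sup>2 + 3/4" by (simp add: power2_eq_square algebra_simps)
  moreover have "(w + 3/2)\<^sup>2 \<ge> 0" by simp
  ultimately have "w\<^sup>2 + 3 * w + 3 > 0" by linarith
  moreover have "D * y\<^sup>2 \<ge> 0" using D by auto
  ultimately have "w \<ge> 0" unfolding weq by (simp add: zero_le_mult_iff)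
  hence w0: "w > 0" using \<open>x \<noteq> 1\<close> by (simp add: w_def)
  have "w \<in> \<rat>" using xy by (simp add: w_def)
  then obtain p q :: nat where pq: "q \<noteq> 0" "\<bar>w\<bar> = real p / real q" "coprime p q"
    by (rule Rats_abs_nat_div_natE)
  have w: "w = real p / real q" using pq(2) w0 by simp
  hence pw: "real p = w * real q" using pq(1) by simp
  have p0: "p > 0" using w w0 by (auto intro: Nat.gr0I)
  define Z where "Z = p * q * (p\<^sup>2 + 3 * p * q + 3 * q\<^sup>2)"
  have "D * (y * (real q)\<^sup>2)\<^sup>2 = real q ^ 4 * (w * (w\<^sup>2 + 3 * w + 3))"
    unfolding weq[symmetric] by (simp add: power2_eq_square power4_eq_xxxx algebra_simps)
  also have "\<dots> = real Z"
    unfolding Z_def by (simp add: pw algebra_simps power2_eq_square power4_eq_xxxx)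
  finally have Z: "D * (y * (real q)\<^sup>2)\<^sup>2 = real Z" .
  have DQ: "D \<in> \<rat>" using D by auto
  \<comment> \<open>The extra factor \<open>D\<close> yields a rational number with integral square,
    hence an integer.\<close>
  have "(D * (y * (real q)\<^sup>2))\<^sup>2 = D * real Z"
    unfolding Z[symmetric] by (simp add: power2_eq_square)
  moreover have "D * real Z \<in> \<int>" using D by auto
  moreover have "D * (y * (real q)\<^sup>2) \<in> \<rat>" using DQ xy by simp
  ultimately have "D * (y * (real q)\<^sup>2) \<in> \<int>" using rational_square_Ints by metis
  then obtain k where k: "D * (y * (real q)\<^sup>2) = of_int k" by (elim Ints_cases)
  have N: "D * real Z = real ((nat \<bar>k\<bar>)\<^sup>2)"
    using \<open>(D * (y * (real q)\<^sup>2))\<^sup>2 = D * real Z\<close> unfolding k by simp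
  from D show False
  proof
    assume "D = 1"
    hence "Z = (nat \<bar>k\<bar>)\<^sup>2" using N by (simp flip: of_nat_eq_iff[where 'a=real])
    thus False using cubic_form_not_square[of p q] p0 pq unfolding Z_def by simp
  next
    assume "D = 3"
    hence "real (3 * Z) = real ((nat \<bar>k\<bar>)\<^sup>2)" using N by simp
    hence "3 * Z = (nat \<bar>k\<bar>)\<^sup>2" by (simp only: of_nat_eq_iff)
    thus False using three_cubic_form_not_square[of p q] p0 pq unfolding Z_def by simp
  qed
qed

text \<open>The points with \<open>x = 0\<close> are the affine kernel of a 3-isogeny onto a curve
  of \<open>cube_minus_one_rational\<close>. Every other rational point maps to
  \<open>u = 1\<close>, whose preimages satisfy \<open>(x + 1) * (x - 2)\<^sup>2 = 0\<close>. For
  \<open>D = 3\<close>, the values 0 and 2 of \<open>x\<close> would make \<open>sqrt 3\<close>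
  rational.\<close>

lemma cube_plus_one_rational:
  fixes x y D :: real
  assumes xy: "x \<in> \<rat>" "y \<in> \<rat>" and D: "D = 1 \<or> D = 3" and eq: "D * y\<^sup>2 = x ^ 3 + 1"
  shows "x = -1 \<or> D = 1 \<and> (x = 0 \<or> x = 2)"
proof (cases "x = 0")
  case True
  have "y\<^sup>2 \<noteq> 1 / 3"
  proof
    assume "y\<^sup>2 = 1 / 3"
    hence "(3 * y)\<^sup>2 = 3" by (simp add: power_mult_distrib)
    thus False using rational_square_neq(2)[of "3 * y"] xy by simp
  qed
  moreover have "D * y\<^sup>2 = 1" using eq True by simp
  ultimately have "D = 1" using D by auto
  thus ?thesis using True by simp
next
  case False
  \<comment> \<open>the 3-isogeny from \<open>D y\<^sup>2 = x\<^sup>3 + 1\<close> to \<open>(3 / D) v\<^sup>2 = u\<^sup>3 - 1\<close>\<close>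
  define u v where "u = (x ^ 3 + 4) / (3 * x\<^sup>2)" and "v = D * y * (x ^ 3 - 8) / (9 * x ^ 3)"
  define E where "E = 3 / D"
  have "E * v\<^sup>2 = 3 * (D * y\<^sup>2) * (x ^ 3 - 8)\<^sup>2 / (81 * (x ^ 3)\<^sup>2)"
    using D by (auto simp: E_def v_def power_mult_distrib power_divide power2_eq_square)
  also have "\<dots> = u ^ 3 - 1"
  proof -
    define t where "t = x ^ 3"
    have "t \<noteq> 0" using False by (simp add: t_def)
    moreover have "u ^ 3 = (t + 4) ^ 3 / (27 * t\<^sup>2)"
      by (simp add: u_def t_def power_divide power_mult_distrib flip: power_mult)
    ultimately show ?thesis
      unfolding eq t_def[symmetric] by (simp add: field_simps power2_eq_square power3_eq_cube)
  qed
  finally have "E * v\<^sup>2 = u ^ 3 - 1" .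
  moreover have "u \<in> \<rat>" "v \<in> \<rat>" "E = 1 \<or> E = 3"
    using D xy by (auto simp: u_def v_def E_def)
  ultimately have "u = 1" using cube_minus_one_rational by blast
  hence "x ^ 3 + 4 = 3 * x\<^sup>2" using False by (simp add: u_def)
  hence "(x + 1) * (x - 2)\<^sup>2 = 0" by (simp add: power2_eq_square power3_eq_cube algebra_simps)
  hence "x = -1 \<or> x = 2" by auto
  moreover have "D \<noteq> 3 \<or> x \<noteq> 2"
  proof (rule ccontr)
    assume "\<not> ?thesis"
    hence "y\<^sup>2 = 3" using eq by simp
    thus False using rational_square_neq(2)[of y] xy by simp
  qed
  ultimately show ?thesis using D by auto
qed

text \<open>In its uses the left side is the discriminant of the rational quadratic with roots
  \<open>x\<close> and its conjugate, where \<open>m\<close> is the slope of the line through the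
  two conjugate points. For \<open>m = p / q\<close> in lowest terms, 3 divides \<open>p\<close>;
  what remains modulo 3 is \<open>l\<^sup>2 + q ^ 4 = 0\<close>, so 3 divides \<open>q\<close>
  too.\<close>

lemma three_adic_quartic_obstruction:
  fixes m n :: real and a b c :: int
  assumes mn: "m \<in> \<rat>" "n \<in> \<rat>"
  shows "m ^ 4 + 3 * a * m\<^sup>2 + 3 * b * m - 3 * (3 * c + 1) \<noteq> 3 * n\<^sup>2"
proof
  assume eq: "m ^ 4 + 3 * a * m\<^sup>2 + 3 * b * m - 3 * (3 * c + 1) = 3 * n\<^sup>2"
  from mn(1) obtain p q where pq: "q > 0" "coprime p q" "m = of_int p / of_int q"
    by (rule Rats_cases')
  hence pm: "of_int p = m * of_int q" by simp
  define Z where "Z = p ^ 4 + 3 * a * p\<^sup>2 * q\<^sup>2 + 3 * b * p * q ^ 3 - 3 * (3 * c + 1) * q ^ 4"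
  have "3 * (n * (of_int q)\<^sup>2)\<^sup>2 = of_int q ^ 4 * (3 * n\<^sup>2)"
    by (simp add: power2_eq_square power4_eq_xxxx)
  also have "\<dots> = of_int Z"
    unfolding eq[symmetric] Z_def
    by (simp add: pm algebra_simps power2_eq_square power3_eq_cube power4_eq_xxxx)
  finally have Z: "3 * (n * (of_int q)\<^sup>2)\<^sup>2 = of_int Z" .
  have Z3: "(3 * (n * (of_int q)\<^sup>2))\<^sup>2 = of_int (3 * Z)"
    using Z by (simp add: power_mult_distrib)
  hence "(3 * (n * (of_int q)\<^sup>2))\<^sup>2 \<in> \<int>" by (metis Ints_of_int)
  moreover have "3 * (n * (of_int q)\<^sup>2) \<in> \<rat>" using mn by simp
  ultimately have "3 * (n * (of_int q)\<^sup>2) \<in> \<int>" by (rule rational_square_Ints[rotated])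
  then obtain k where k: "3 * (n * (of_int q)\<^sup>2) = of_int k" by (elim Ints_cases)
  have kZ: "k\<^sup>2 = 3 * Z" using Z3 unfolding k by (metis of_int_eq_iff of_int_power)
  have p3: "Factorial_Ring.prime (3::int)" by simp
  have "3 dvd k" using kZ prime_dvd_power[OF p3, of k 2] by simp
  then obtain l where "k = 3 * l" by blast
  hence lZ: "3 * l\<^sup>2 = Z" using kZ by (simp add: power_mult_distrib)
  have "p ^ 4 = 3 * (l\<^sup>2 - a * p\<^sup>2 * q\<^sup>2 - b * p * q ^ 3 + (3 * c + 1) * q ^ 4)"
    using lZ unfolding Z_def by (simp add: algebra_simps)
  hence "3 dvd p ^ 4" by simp
  hence "3 dvd p" using prime_dvd_power[OF p3] by blast
  then obtain r where r: "p = 3 * r" by blast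
  have "l\<^sup>2 + (q\<^sup>2)\<^sup>2 = 3 * (9 * r ^ 4 + 3 * a * r\<^sup>2 * q\<^sup>2 + b * r * q ^ 3 - c * q ^ 4)"
    using lZ unfolding Z_def r by (simp add: algebra_simps power2_eq_square power4_eq_xxxx)
  hence "(l\<^sup>2 + (q\<^sup>2)\<^sup>2) mod 3 = 0" by simp
  moreover have sq3: "x\<^sup>2 mod 3 = (if 3 dvd x then 0 else 1)" for x :: int
  proof -
    have "x mod 3 = 0 \<or> x mod 3 = 1 \<or> x mod 3 = 2" by presburger
    hence "(x mod 3)\<^sup>2 mod 3 = (if x mod 3 = 0 then 0 else 1)" by auto
    thus ?thesis by (simp add: power_mod dvd_eq_mod_eq_0)
  qed
  ultimately have "3 dvd q\<^sup>2"
    using sq3[of l] sq3[of "q\<^sup>2"] mod_add_eq[of "l\<^sup>2" 3 "(q\<^sup>2)\<^sup>2"] by (auto split: if_splits)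
  hence "3 dvd q" using prime_dvd_power[OF p3] by blast
  thus False using pq(2) r coprime_common_divisor[of p q 3] by simp
qed

section \<open>Conjugation in real quadratic extensions\<close>

locale real_subfield =
  fixes F :: "real set"
  assumes Rats_subset: "\<rat> \<subseteq> F"
    and add_closed [simp]: "\<lbrakk>x \<in> F; y \<in> F\<rbrakk> \<Longrightarrow> x + y \<in> F"
    and mult_closed [simp]: "\<lbrakk>x \<in> F; y \<in> F\<rbrakk> \<Longrightarrow> x * y \<in> F"
    and uminus_closed [simp]: "x \<in> F \<Longrightarrow> - x \<in> F"
    and inverse_closed [simp]: "x \<in> F \<Longrightarrow> inverse x \<in> F"
begin

lemma rational_closed [simp]: "0 \<in> F" "1 \<in> F" "numeral n \<in> F"
  using Rats_subset by auto

lemma diff_closed [simp]: "\<lbrakk>x \<in> F; y \<in> F\<rbrakk> \<Longrightarrow> x - y \<in> F"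
  using add_closed[of x "- y"] by simp

lemma divide_closed [simp]: "\<lbrakk>x \<in> F; y \<in> F\<rbrakk> \<Longrightarrow> x / y \<in> F"
  by (simp add: divide_inverse)

lemma power_closed [simp]: "x \<in> F \<Longrightarrow> x ^ n \<in> F"
  by (induction n) simp_all

end

text \<open>Both steps of the tower are instances: Q(sqrt 3) over the rationals, and K over Q(sqrt
  3).\<close>

locale quadratic_extension = real_subfield F for F +
  fixes r :: real
  assumes square_in: "r\<^sup>2 \<in> F" and not_in: "r \<notin> F"
begin

definition extension :: "real set" where
  "extension = {u + v * r | u v. u \<in> F \<and> v \<in> F}"

text \<open>A total function on the reals: outside \<open>extension\<close> no coordinates exist and
  the value is unspecified, so its rules ask for membership.\<close>

definition conjugate :: "real \<Rightarrow> real" where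
  "conjugate x = (THE c. \<exists>u\<in>F. \<exists>v\<in>F. x = u + v * r \<and> c = u - v * r)"

lemma extensionI [intro]: "\<lbrakk>u \<in> F; v \<in> F\<rbrakk> \<Longrightarrow> u + v * r \<in> extension"
  unfolding extension_def by blast

lemma extensionE [elim?]:
  assumes "x \<in> extension"
  obtains u v where "u \<in> F" "v \<in> F" "x = u + v * r"
  using assms unfolding extension_def by blast

lemma coordinates_unique:
  assumes "u \<in> F" "v \<in> F" "u' \<in> F" "v' \<in> F" and eq: "u + v * r = u' + v' * r"
  shows "u = u'" "v = v'"
proof -
  have "v = v'"
  proof (rule ccontr)
    assume "v \<noteq> v'"
    hence "r = (u' - u) / (v - v')" using eq by (simp add: field_simps)
    thus False using assms not_in by simp
  qed
  thus "v = v'" "u = u'" using eq by simp_all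
qed

lemma conjugate_eq: "\<lbrakk>u \<in> F; v \<in> F\<rbrakk> \<Longrightarrow> conjugate (u + v * r) = u - v * r"
  unfolding conjugate_def
proof (rule the_equality)
  fix c assume "u \<in> F" "v \<in> F" "\<exists>u'\<in>F. \<exists>v'\<in>F. u + v * r = u' + v' * r \<and> c = u' - v' * r"
  thus "c = u - v * r" using coordinates_unique by metis
qed blast

lemma conjugate_base [simp]: "x \<in> F \<Longrightarrow> conjugate x = x"
  using conjugate_eq[of x 0] by simp

lemma base_subset: "F \<subseteq> extension"
  using extensionI[of _ 0] by auto

lemma generator_in_extension: "r \<in> extension"
  using extensionI[of 0 1] by simp

lemma conjugate_in_extension: "x \<in> extension \<Longrightarrow> conjugate x \<in> extension"
proof (erule extensionE)
  fix u v assume "u \<in> F" "v \<in> F" "x = u + v * r"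
  thus "conjugate x \<in> extension" using extensionI[of u "- v"] by (simp add: conjugate_eq)
qed

lemma extension_add:
  assumes "x \<in> extension" "y \<in> extension"
  shows "x + y \<in> extension" "conjugate (x + y) = conjugate x + conjugate y"
proof -
  obtain u v where x: "u \<in> F" "v \<in> F" "x = u + v * r" using assms(1) by (rule extensionE)
  obtain u' v' where y: "u' \<in> F" "v' \<in> F" "y = u' + v' * r" using assms(2) by (rule extensionE)
  have c: "conjugate x = u - v * r" "conjugate y = u' - v' * r"
    using x y by (simp_all add: conjugate_eq)
  have eq: "x + y = (u + u') + (v + v') * r" using x y by (simp add: algebra_simps)
  show "x + y \<in> extension" unfolding eq using x y by (intro extensionI) simp_all
  have "conjugate (x + y) = (u + u') - (v + v') * r"
    unfolding eq using x y by (intro conjugate_eq) simp_all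
  thus "conjugate (x + y) = conjugate x + conjugate y"
    by (simp add: c algebra_simps)
qed

lemma extension_mult:
  assumes "x \<in> extension" "y \<in> extension"
  shows "x * y \<in> extension" "conjugate (x * y) = conjugate x * conjugate y"
proof -
  obtain u v where x: "u \<in> F" "v \<in> F" "x = u + v * r" using assms(1) by (rule extensionE)
  obtain u' v' where y: "u' \<in> F" "v' \<in> F" "y = u' + v' * r" using assms(2) by (rule extensionE)
  have c: "conjugate x = u - v * r" "conjugate y = u' - v' * r"
    using x y by (simp_all add: conjugate_eq)
  have eq: "x * y = (u * u' + v * v' * r\<^sup>2) + (u * v' + v * u') * r"
    using x y by (simp add: algebra_simps power2_eq_square)
  show "x * y \<in> extension" unfolding eq using x y square_in by (intro extensionI) simp_all
  have "conjugate (x * y) = (u * u' + v * v' * r\<^sup>2) - (u * v' + v * u') * r"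
    unfolding eq using x y square_in by (intro conjugate_eq) simp_all
  thus "conjugate (x * y) = conjugate x * conjugate y"
    by (simp add: c algebra_simps power2_eq_square)
qed

lemma conjugate_eq_0_iff:
  assumes "x \<in> extension"
  shows "conjugate x = 0 \<longleftrightarrow> x = 0"
proof
  assume 0: "conjugate x = 0"
  obtain u v where x: "u \<in> F" "v \<in> F" "x = u + v * r" using assms by (rule extensionE)
  hence "u + (- v) * r = 0 + 0 * r" using 0 by (simp add: conjugate_eq)
  from coordinates_unique[OF _ _ _ _ this] show "x = 0" using x by simp
qed simp

lemma extension_inverse:
  assumes "x \<in> extension"
  shows "inverse x \<in> extension"
proof (cases "x = 0")
  case True
  thus ?thesis using base_subset by auto
next
  case False
  obtain u v where x: "u \<in> F" "v \<in> F" "x = u + v * r" using assms by (rule extensionE)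
  have "conjugate x \<noteq> 0" using False assms by (simp add: conjugate_eq_0_iff)
  hence "inverse x = conjugate x / (x * conjugate x)" using False by (simp add: field_simps)
  also have "x * conjugate x = u\<^sup>2 - v\<^sup>2 * r\<^sup>2"
    unfolding x(3) conjugate_eq[OF x(1,2)] by (simp add: algebra_simps power2_eq_square)
  also have "conjugate x / (u\<^sup>2 - v\<^sup>2 * r\<^sup>2) = inverse (u\<^sup>2 - v\<^sup>2 * r\<^sup>2) * conjugate x"
    by (simp add: field_simps)
  also have "inverse (u\<^sup>2 - v\<^sup>2 * r\<^sup>2) \<in> extension"
    using x square_in base_subset by (meson diff_closed inverse_closed mult_closed power_closed subsetD)
  hence "inverse (u\<^sup>2 - v\<^sup>2 * r\<^sup>2) * conjugate x \<in> extension"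
    using assms by (intro extension_mult conjugate_in_extension)
  finally show ?thesis .
qed

text \<open>Allows a second quadratic extension on top of the first.\<close>

sublocale ext: real_subfield extension
proof
  show "\<rat> \<subseteq> extension" using Rats_subset base_subset by blast
  show "- x \<in> extension" if "x \<in> extension" for x
    using extension_mult(1)[of "-1" x] subsetD[OF base_subset, of "-1"] that by simp
qed (simp_all add: extension_add extension_mult extension_inverse)

lemmas conjugate_add = extension_add(2) and conjugate_mult = extension_mult(2)

lemma conjugate_diff: "\<lbrakk>x \<in> extension; y \<in> extension\<rbrakk> \<Longrightarrow> conjugate (x - y) = conjugate x - conjugate y"
  using conjugate_add[of "x - y" y] by simp

lemma conjugate_minus: "x \<in> extension \<Longrightarrow> conjugate (- x) = - conjugate x"
  using conjugate_diff[of 0 x] by simp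

lemma conjugate_power: "x \<in> extension \<Longrightarrow> conjugate (x ^ n) = conjugate x ^ n"
  by (induction n) (simp_all add: conjugate_mult)

lemma conjugate_divide:
  assumes "x \<in> extension" "y \<in> extension"
  shows "conjugate (x / y) = conjugate x / conjugate y"
proof (cases "y = 0")
  case False
  have "conjugate x = conjugate (x / y) * conjugate y"
    using False assms conjugate_mult[of "x / y" y] by simp
  thus ?thesis using False assms by (simp add: conjugate_eq_0_iff)
qed simp

lemma conjugate_conjugate:
  assumes "x \<in> extension"
  shows "conjugate (conjugate x) = x"
proof -
  obtain u v where "u \<in> F" "v \<in> F" "x = u + v * r" using assms by (rule extensionE)
  thus ?thesis using conjugate_eq[of u "- v"] by (simp add: conjugate_eq)
qed

lemma conjugate_diff_eq:
  assumes "x \<in> extension"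
  obtains v where "v \<in> F" "x - conjugate x = 2 * v * r"
proof -
  obtain u v where "u \<in> F" "v \<in> F" "x = u + v * r" using assms by (rule extensionE)
  thus ?thesis using that by (simp add: conjugate_eq)
qed

lemma conjugate_fixed: "\<lbrakk>x \<in> extension; conjugate x = x\<rbrakk> \<Longrightarrow> x \<in> F"
proof (erule extensionE)
  fix u v assume *: "u \<in> F" "v \<in> F" "x = u + v * r" "conjugate x = x"
  hence "x = u" by (simp add: conjugate_eq)
  thus "x \<in> F" using * by blast
qed

lemma conjugate_negated:
  assumes "x \<in> extension" "conjugate x = - x"
  obtains v where "v \<in> F" "x = v * r"
proof -
  obtain v where "v \<in> F" "x - conjugate x = 2 * v * r" using conjugate_diff_eq[OF assms(1)] .
  thus ?thesis using that assms(2) by simp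
qed

lemma conjugate_square_fixed:
  assumes "x \<in> extension" "conjugate (x\<^sup>2) = x\<^sup>2"
  shows "conjugate x = x \<or> conjugate x = - x"
  using assms by (simp add: conjugate_power power2_eq_iff)

text \<open>
  The line through a point and its conjugate is defined over the base field, so it meets the curve
  in a third point \<open>(a, b)\<close> over the base field.
\<close>
lemma conjugate_third_point:
  assumes xy: "x \<in> extension" "y \<in> extension" and c: "c \<in> F"
    and curve: "y\<^sup>2 = x ^ 3 + c" and ne: "conjugate x \<noteq> x"
  obtains m a b where "m \<in> F" "a \<in> F" "b \<in> F" "b\<^sup>2 = a ^ 3 + c"
    "y = b + m * (x - a)" "x + conjugate x + a = m\<^sup>2"
    "x * conjugate x + a * (x + conjugate x) = - 2 * m * (b - m * a)"
proof -
  define x' y' where "x' = conjugate x" and "y' = conjugate y"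
  have xy': "x' \<in> extension" "y' \<in> extension"
    using xy by (simp_all add: x'_def y'_def conjugate_in_extension)
  have conj': "conjugate x' = x" "conjugate y' = y"
    using xy by (simp_all add: x'_def y'_def conjugate_conjugate)
  have "conjugate (y\<^sup>2) = conjugate (x ^ 3 + c)" by (simp only: curve)
  hence curve': "y'\<^sup>2 = x' ^ 3 + c"
    using xy c base_subset by (auto simp: x'_def y'_def conjugate_power conjugate_add)
  have d: "x - x' \<noteq> 0" using ne by (simp add: x'_def)
  define m where "m = (y - y') / (x - x')"
  define k where "k = y - m * x"
  \<comment> \<open>By Vieta the three abscissae on the line \<open>v = m * u + k\<close> add up to
    \<open>m\<^sup>2\<close>; the linear coefficient gives \<open>s2\<close>.\<close>
  define a where "a = m\<^sup>2 - (x + x')"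
  define b where "b = m * a + k"
  have y: "y = m * x + k" by (simp add: k_def)
  have "m * (x - x') = y - y'" using d by (simp add: m_def)
  hence y': "y' = m * x' + k" by (simp add: k_def algebra_simps)
  have mE: "m \<in> extension" using xy xy' by (simp add: m_def)
  have "conjugate m = (y' - y) / (x' - x)"
    using xy xy' conj' unfolding m_def by (simp add: conjugate_divide conjugate_diff flip: x'_def y'_def)
  also have "\<dots> = m" unfolding m_def by (metis minus_diff_eq minus_divide_divide)
  finally have m: "m \<in> F" using mE conjugate_fixed by blast
  have kE: "k \<in> extension" using xy mE by (simp add: k_def)
  have "conjugate k = y' - m * x'"
    using xy mE m unfolding k_def by (simp add: conjugate_diff conjugate_mult flip: x'_def y'_def)
  hence "conjugate k = k" using y' by simp
  hence k: "k \<in> F" using kE conjugate_fixed by blast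
  have "conjugate (x + x') = x + x'"
    using xy xy' conj' by (simp add: conjugate_add flip: x'_def)
  hence "x + x' \<in> F" using xy xy' conjugate_fixed[of "x + x'"] by simp
  hence a: "a \<in> F" using m by (simp add: a_def)
  hence b: "b \<in> F" using m k by (simp add: b_def)
  have e: "x ^ 3 + c = (m * x + k)\<^sup>2" "x' ^ 3 + c = (m * x' + k)\<^sup>2"
    using curve curve' y y' by simp_all
  have "(x - x') * (x\<^sup>2 + x * x' + x'\<^sup>2 - m\<^sup>2 * (x + x') - 2 * m * k) = 0"
    using e by (simp add: algebra_simps power2_eq_square power3_eq_cube)
  hence q: "x\<^sup>2 + x * x' + x'\<^sup>2 = m\<^sup>2 * (x + x') + 2 * m * k" using d by simp
  have s1: "m\<^sup>2 = x + x' + a" by (simp add: a_def)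
  have s2: "x * x' + a * (x + x') = - 2 * m * k"
    using q unfolding a_def by (simp add: algebra_simps power2_eq_square)
  have "a\<^sup>2 + a * x + x\<^sup>2 - m\<^sup>2 * (a + x) - 2 * m * k = 0"
    using s2 unfolding s1 by (simp add: algebra_simps power2_eq_square)
  \<comment> \<open>The difference of \<open>t ^ 3 + c - (m * t + k)\<^sup>2\<close> at
    \<open>a\<close> and \<open>x\<close> has factor \<open>a - x\<close>; the cofactor vanishes by
    the previous line, so \<open>a\<close> is a root because \<open>x\<close> is.\<close>
  moreover have "a ^ 3 + c - (m * a + k)\<^sup>2 = (x ^ 3 + c - (m * x + k)\<^sup>2)
      + (a - x) * (a\<^sup>2 + a * x + x\<^sup>2 - m\<^sup>2 * (a + x) - 2 * m * k)"
    by (simp add: algebra_simps power2_eq_square power3_eq_cube)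
  ultimately have "b\<^sup>2 = a ^ 3 + c" using e(1) by (simp add: b_def)
  moreover have "y = b + m * (x - a)" unfolding y b_def by (simp add: algebra_simps)
  moreover have "x + conjugate x + a = m\<^sup>2" unfolding a_def x'_def by simp
  moreover have "x * conjugate x + a * (x + conjugate x) = - 2 * m * (b - m * a)"
    using s2 unfolding b_def x'_def[symmetric] by (simp add: algebra_simps)
  ultimately show ?thesis using that m a b by blast
qed

end

section \<open>Points over the quadratic and biquadratic fields\<close>

interpretation Q3: quadratic_extension \<rat> "sqrt 3"
  by unfold_locales (use rational_square_neq(2)[of "sqrt 3"] in auto)

lemma sqrt2_notin_Q3: "sqrt 2 \<notin> Q3.extension"
proof
  assume "sqrt 2 \<in> Q3.extension"
  then obtain u v where uv: "u \<in> \<rat>" "v \<in> \<rat>" "sqrt 2 = u + v * sqrt 3"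
    by (rule Q3.extensionE)
  have "2 = (u + v * sqrt 3)\<^sup>2" unfolding uv(3)[symmetric] by simp
  also have "\<dots> = (u\<^sup>2 + 3 * v\<^sup>2) + (2 * u * v) * sqrt 3"
    by (simp add: power2_sum power_mult_distrib)
  finally have "(u\<^sup>2 + 3 * v\<^sup>2) + (2 * u * v) * sqrt 3 = 2 + 0 * sqrt 3" by simp
  hence *: "u\<^sup>2 + 3 * v\<^sup>2 = 2" "2 * u * v = 0"
    using uv Q3.coordinates_unique[of "u\<^sup>2 + 3 * v\<^sup>2" "2 * u * v" 2 0] by simp_all
  show False
  proof (cases "u = 0")
    case True
    hence "(3 * v)\<^sup>2 = 6" using * by (simp add: power_mult_distrib)
    thus False using rational_square_neq(3)[of "3 * v"] uv by simp
  next
    case False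
    hence "u\<^sup>2 = 2" using * by simp
    thus False using rational_square_neq(1) uv by blast
  qed
qed

interpretation K: quadratic_extension Q3.extension "sqrt 2"
  by unfold_locales (use sqrt2_notin_Q3 in auto)

text \<open>Carries elements of the generated field of the statement into the concrete tower, which
  contains the generators and is closed under the field operations.\<close>

lemma Q_sqrt2_sqrt3_subset: "Q_sqrt2_sqrt3 \<subseteq> K.extension"
proof
  let ?R = "ring_of_type_algebra :: real ring"
  interpret R: Ring.field ?R ..
  have inv: "inv\<^bsub>?R\<^esub> h = inverse h" if "h \<noteq> 0" for h
    by (rule R.comm_inv_char) (use that in \<open>auto simp: ring_of_type_algebra_def\<close>)
  fix x assume "x \<in> Q_sqrt2_sqrt3"
  hence "x \<in> generate_field ?R (\<rat> \<union> {sqrt 2, sqrt 3})" by (simp add: Q_sqrt2_sqrt3_def)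
  thus "x \<in> K.extension"
  proof (induction rule: generate_field.induct)
    case (incl h)
    thus ?case
      using K.ext.Rats_subset K.generator_in_extension Q3.generator_in_extension K.base_subset by auto
  next
    case (a_inv h)
    have "\<ominus>\<^bsub>?R\<^esub> h = - h"
      by (rule R.sum_zero_eq_neg[symmetric]) (auto simp: ring_of_type_algebra_def)
    thus ?case using a_inv by simp
  next
    case (m_inv h)
    have "h \<noteq> 0" using m_inv.hyps(2) by (simp add: ring_of_type_algebra_def)
    thus ?case using m_inv.IH by (simp add: inv)
  qed (simp_all add: ring_of_type_algebra_def)
qed

text \<open>For rational \<open>x\<close>, either \<open>y\<close> or \<open>y / sqrt 3\<close> is
  rational, which is the case \<open>D = 1\<close> or \<open>D = 3\<close> over the rationals.
  Otherwise the third point is \<open>(1, 0)\<close>, and the discriminant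
  \<open>m ^ 4 - 6 * m\<^sup>2 - 3\<close> would be 3 times a rational square.\<close>

lemma cube_minus_one_Q3:
  assumes xy: "x \<in> Q3.extension" "y \<in> Q3.extension" and eq: "y\<^sup>2 = x ^ 3 - 1"
  shows "x = 1"
proof (cases "Q3.conjugate x = x")
  case True
  hence x: "x \<in> \<rat>" using xy Q3.conjugate_fixed by blast
  have "Q3.conjugate (y\<^sup>2) = y\<^sup>2" using x eq by simp
  hence "Q3.conjugate y = y \<or> Q3.conjugate y = - y" using xy Q3.conjugate_square_fixed by blast
  thus ?thesis
  proof
    assume "Q3.conjugate y = y"
    hence "y \<in> \<rat>" using xy Q3.conjugate_fixed by blast
    thus ?thesis using cube_minus_one_rational[of x y 1] x eq by simp
  next
    assume "Q3.conjugate y = - y"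
    then obtain v where v: "v \<in> \<rat>" "y = v * sqrt 3" using xy Q3.conjugate_negated by metis
    have "3 * v\<^sup>2 = x ^ 3 - 1" using eq unfolding v(2) by (simp add: power_mult_distrib)
    thus ?thesis using cube_minus_one_rational[of x v 3] x v by simp
  qed
next
  case False
  have "y\<^sup>2 = x ^ 3 + (- 1)" using eq by simp
  moreover have "- 1 \<in> \<rat>" by simp
  ultimately
  obtain m a b where mab: "m \<in> \<rat>" "a \<in> \<rat>" "b \<in> \<rat>" "b\<^sup>2 = a ^ 3 + (- 1)"
    "x + Q3.conjugate x + a = m\<^sup>2"
    "x * Q3.conjugate x + a * (x + Q3.conjugate x) = - 2 * m * (b - m * a)"
    using Q3.conjugate_third_point[OF xy _ _ False] by metis
  have a: "a = 1" using cube_minus_one_rational[of a b 1] mab by simp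
  hence b: "b = 0" using mab by simp
  obtain v where v: "v \<in> \<rat>" "x - Q3.conjugate x = 2 * v * sqrt 3"
    using Q3.conjugate_diff_eq[OF xy(1)] .
  have s: "x + Q3.conjugate x = m\<^sup>2 - 1" using mab(5) a by simp
  hence p: "x * Q3.conjugate x = m\<^sup>2 + 1"
    using mab(6) by (simp add: a b power2_eq_square)
  have "3 * (2 * v)\<^sup>2 = (x - Q3.conjugate x)\<^sup>2" unfolding v(2) by (simp add: power_mult_distrib)
  also have "\<dots> = (x + Q3.conjugate x)\<^sup>2 - 4 * (x * Q3.conjugate x)"
    by (simp add: power2_eq_square algebra_simps)
  also have "\<dots> = m ^ 4 + 3 * of_int (- 2) * m\<^sup>2 + 3 * of_int 0 * m - 3 * (3 * of_int 0 + 1)"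
    unfolding s p by (simp add: power2_eq_square power4_eq_xxxx algebra_simps)
  finally show ?thesis
    using three_adic_quartic_obstruction[of m "2 * v" "-2" 0 0] mab v by simp
qed

text \<open>The sign conditions discard the known points: a rational \<open>x\<close> would be -1, 0
  or 2, and otherwise the third abscissa \<open>a = m\<^sup>2 - (x + Q3.conjugate x)\<close> is
  positive, so \<open>a = 2\<close>. The 3-adic obstruction then applies as in
  \<open>cube_minus_one_Q3\<close>.\<close>

lemma cube_plus_one_Q3:
  assumes xy: "x \<in> Q3.extension" "y \<in> Q3.extension" and eq: "y\<^sup>2 = x ^ 3 + 1"
    and x: "-1 < x" "x < 0" and x': "Q3.conjugate x < 0"
  shows False
proof (cases "Q3.conjugate x = x")
  case True
  hence xQ: "x \<in> \<rat>" using xy Q3.conjugate_fixed by blast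
  have "Q3.conjugate (y\<^sup>2) = y\<^sup>2" using xQ eq by simp
  hence "Q3.conjugate y = y \<or> Q3.conjugate y = - y" using xy Q3.conjugate_square_fixed by blast
  thus ?thesis
  proof
    assume "Q3.conjugate y = y"
    hence "y \<in> \<rat>" using xy Q3.conjugate_fixed by blast
    thus ?thesis using cube_plus_one_rational[of x y 1] xQ eq x by simp
  next
    assume "Q3.conjugate y = - y"
    then obtain v where v: "v \<in> \<rat>" "y = v * sqrt 3" using xy Q3.conjugate_negated by metis
    have "3 * v\<^sup>2 = x ^ 3 + 1" using eq unfolding v(2) by (simp add: power_mult_distrib)
    thus ?thesis using cube_plus_one_rational[of x v 3] xQ v x by simp
  qed
next
  case False
  have "1 \<in> \<rat>" by simp
  from Q3.conjugate_third_point[OF xy this eq False]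
  obtain m a b where mab: "m \<in> \<rat>" "a \<in> \<rat>" "b \<in> \<rat>" "b\<^sup>2 = a ^ 3 + 1"
    "x + Q3.conjugate x + a = m\<^sup>2"
    "x * Q3.conjugate x + a * (x + Q3.conjugate x) = - 2 * m * (b - m * a)"
    by metis
  have "a = -1 \<or> a = 0 \<or> a = 2" using cube_plus_one_rational[of a b 1] mab by auto
  moreover have "a > 0" using mab(5) x x' zero_le_power2[of m] by linarith
  ultimately have a: "a = 2" by auto
  hence "b\<^sup>2 = 3\<^sup>2" using mab(4) by simp
  hence "b = 3 \<or> b = - 3" by (simp only: power2_eq_iff)
  \<comment> \<open>The sign \<open>s\<close> treats the third points \<open>(2, 3)\<close> and
    \<open>(2, -3)\<close> together.\<close>
  then obtain s where b: "b = 3 * of_int s" "s = 1 \<or> s = - 1" by (metis mult_minus1_right mult_1_right of_int_1 of_int_minus)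
  obtain v where v: "v \<in> \<rat>" "x - Q3.conjugate x = 2 * v * sqrt 3"
    using Q3.conjugate_diff_eq[OF xy(1)] .
  have s: "x + Q3.conjugate x = m\<^sup>2 - 2" using mab(5) a by simp
  have p: "x * Q3.conjugate x = 4 + 2 * m\<^sup>2 - 6 * of_int s * m"
    using mab(6) unfolding s by (simp add: a b(1) power2_eq_square algebra_simps)
  have "3 * (2 * v)\<^sup>2 = (x - Q3.conjugate x)\<^sup>2" unfolding v(2) by (simp add: power_mult_distrib)
  also have "\<dots> = (x + Q3.conjugate x)\<^sup>2 - 4 * (x * Q3.conjugate x)"
    by (simp add: power2_eq_square algebra_simps)
  also have "\<dots> = m ^ 4 + 3 * of_int (- 4) * m\<^sup>2 + 3 * of_int (8 * s) * m - 3 * (3 * of_int 1 + 1)"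
    unfolding s p by (simp add: power2_eq_square power4_eq_xxxx algebra_simps)
  finally show ?thesis
    using three_adic_quartic_obstruction[of m "2 * v" "-4" "8 * s" 1] mab v by simp
qed

text \<open>The alternatives describe the line through the point
  \<open>(1 / x\<^sup>2, (y / x) ^ 3)\<close> of \<open>v\<^sup>2 = u ^ 3 - 1\<close> and its
  conjugate: vertical, or passing through \<open>(1, 0)\<close>.\<close>

lemma conjugate_cases:
  assumes xy: "x \<in> K.extension" "y \<in> K.extension" "x \<noteq> 0" "x ^ 6 + y ^ 6 = 1"
  shows "(K.conjugate (x\<^sup>2) = x\<^sup>2 \<and> K.conjugate ((y / x) ^ 3) = - ((y / x) ^ 3)) \<or>
    (1 / x\<^sup>2 - 1) * (1 / K.conjugate (x\<^sup>2) - 1) = 3"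
proof -
  define p q where "p = 1 / x\<^sup>2" and "q = (y / x) ^ 3"
  have pq: "p \<in> K.extension" "q \<in> K.extension" using xy by (simp_all add: p_def q_def)
  have p': "K.conjugate p = 1 / K.conjugate (x\<^sup>2)"
    using xy by (simp add: p_def K.conjugate_divide)
  have "q\<^sup>2 = y ^ 6 / x ^ 6" by (simp add: q_def power_divide flip: power_mult)
  also have "y ^ 6 = 1 - x ^ 6" using xy by simp
  also have "(1 - x ^ 6) / x ^ 6 = p ^ 3 - 1"
    using xy by (simp add: p_def power_divide diff_divide_distrib flip: power_mult)
  finally have eq: "q\<^sup>2 = p ^ 3 + (- 1)" by simp
  show ?thesis
  proof (cases "K.conjugate p = p")
    case True
    hence pF: "p \<in> Q3.extension" using pq K.conjugate_fixed by blast
    hence "q\<^sup>2 \<in> Q3.extension" using eq by simp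
    hence "K.conjugate (q\<^sup>2) = q\<^sup>2" by simp
    hence "K.conjugate q = q \<or> K.conjugate q = - q" using pq K.conjugate_square_fixed by blast
    \<comment> \<open>A fixed \<open>q\<close> gives a point over Q(sqrt 3), so
      \<open>q = 0\<close>, which is negated as well.\<close>
    moreover have "K.conjugate q = - q" if "K.conjugate q = q"
    proof -
      have "q \<in> Q3.extension" using that pq K.conjugate_fixed by blast
      hence "p = 1" using pF eq cube_minus_one_Q3[of p q] by simp
      hence "q = 0" using eq by simp
      thus ?thesis by simp
    qed
    ultimately have "K.conjugate q = - q" by blast
    moreover have "K.conjugate (x\<^sup>2) = x\<^sup>2" using True unfolding p' by (simp add: p_def)
    ultimately show ?thesis by (simp add: q_def)
  next
    case False
    have "- 1 \<in> Q3.extension" by simp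
    from K.conjugate_third_point[OF pq this eq False]
    obtain m a b where mab: "a \<in> Q3.extension" "b \<in> Q3.extension" "b\<^sup>2 = a ^ 3 + (- 1)"
      "p + K.conjugate p + a = m\<^sup>2"
      "p * K.conjugate p + a * (p + K.conjugate p) = - 2 * m * (b - m * a)"
      by metis
    have a: "a = 1" using cube_minus_one_Q3[of a b] mab by simp
    hence b: "b = 0" using mab by simp
    \<comment> \<open>Eliminates \<open>m\<^sup>2\<close> from the two Vieta relations at
      \<open>a = 1\<close>, \<open>b = 0\<close>.\<close>
    have "(p - 1) * (K.conjugate p - 1) = 3"
      using mab(4,5) unfolding a b by (simp add: algebra_simps power2_eq_square)
    thus ?thesis unfolding p' by (simp add: p_def)
  qed
qed

section \<open>Positivity in the real embeddings\<close>

lemma square_fixed_form: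
  assumes "y \<in> K.extension" "K.conjugate (y\<^sup>2) = y\<^sup>2"
  obtains d b where "b \<in> Q3.extension" "d = 1 \<or> d = 2" "y\<^sup>2 = d * b\<^sup>2"
proof -
  consider "K.conjugate y = y" | "K.conjugate y = - y"
    using K.conjugate_square_fixed assms by blast
  thus ?thesis
  proof cases
    case 1
    thus ?thesis using that[of y 1] K.conjugate_fixed[OF assms(1) 1] by simp
  next
    case 2
    obtain b where "b \<in> Q3.extension" "y = b * sqrt 2"
      using K.conjugate_negated[OF assms(1) 2] .
    thus ?thesis using that[of b 2] by (simp add: power_mult_distrib)
  qed
qed

text \<open>When \<open>y\<^sup>2\<close> is fixed, the product in the second alternative of
  \<open>conjugate_cases\<close> becomes this square.\<close>

lemma inverse_square_minus_one_neq:
  assumes y: "y \<in> K.extension" "y \<noteq> 0" "K.conjugate (y\<^sup>2) = y\<^sup>2"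
  shows "(1 / y\<^sup>2 - 1)\<^sup>2 \<noteq> 3"
proof
  assume *: "(1 / y\<^sup>2 - 1)\<^sup>2 = 3"
  obtain d b where b: "b \<in> Q3.extension" "d = 1 \<or> d = 2" "y\<^sup>2 = d * b\<^sup>2"
    using square_fixed_form[OF y(1,3)] .
  define t where "t = 1 / y\<^sup>2"
  have b0: "b \<noteq> 0" using b(3) y(2) by auto
  have dF: "d \<in> \<rat>" using b(2) by auto
  have tF: "t = 1 / (d * b\<^sup>2)" by (simp add: t_def b(3))
  have d: "d \<in> Q3.extension" using dF Q3.base_subset by blast
  have "Q3.conjugate t = 1 / (d * (Q3.conjugate b)\<^sup>2)"
    unfolding tF using b(1) d dF by (simp add: Q3.conjugate_divide Q3.conjugate_mult Q3.conjugate_power)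
  \<comment> \<open>\<open>t\<close> is a square up to a factor \<open>d > 0\<close>, hence totally positive, but \<open>1 + sqrt 3\<close> is not\<close>
  hence pos: "Q3.conjugate t > 0" using b b0 by (auto simp: Q3.conjugate_eq_0_iff)
  have "(t - 1)\<^sup>2 = (sqrt 3)\<^sup>2" using * by (simp add: t_def)
  hence "t - 1 = sqrt 3 \<or> t - 1 = - sqrt 3" by (simp only: power2_eq_iff)
  moreover have "t > 0" using y(2) by (simp add: t_def)
  moreover have s: "sqrt 3 > 1" by simp
  ultimately have "t = 1 + 1 * sqrt 3" by auto
  hence "Q3.conjugate t = 1 - 1 * sqrt 3" using Q3.conjugate_eq[of 1 1] by simp
  thus False using pos s by simp
qed

text \<open>With \<open>y = b * sqrt 2\<close>, the equation puts
  \<open>(- (2 * b\<^sup>2), x ^ 3)\<close> on \<open>v\<^sup>2 = u ^ 3 + 1\<close>. Its abscissa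
  and the conjugate of it are negative, and \<open>x \<noteq> 0\<close> keeps the abscissa above -1,
  as \<open>cube_plus_one_Q3\<close> requires.\<close>

lemma no_solution_fixed_negated:
  assumes xy: "x \<in> K.extension" "y \<in> K.extension" "x \<noteq> 0" "y \<noteq> 0" "x ^ 6 + y ^ 6 = 1"
    and c: "K.conjugate x = x" "K.conjugate y = - y"
  shows False
proof -
  have x: "x \<in> Q3.extension" using xy c K.conjugate_fixed by blast
  obtain b where b: "b \<in> Q3.extension" "y = b * sqrt 2" using K.conjugate_negated[OF xy(2) c(2)] .
  have b0: "b \<noteq> 0" using xy b by auto
  define p where "p = - (2 * b\<^sup>2)"
  have p: "p \<in> Q3.extension" using b by (simp add: p_def)
  have y2: "y\<^sup>2 = - p" by (simp add: p_def b(2) power_mult_distrib)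
  have "y ^ 6 = (y\<^sup>2) ^ 3" by (simp flip: power_mult)
  hence y6: "y ^ 6 = - (p ^ 3)" by (simp add: y2)
  have eq: "(x ^ 3)\<^sup>2 = p ^ 3 + 1" using xy(5) unfolding y6 by (simp flip: power_mult)
  have "(x ^ 3)\<^sup>2 > 0" using xy by simp
  hence "p ^ 3 + 1 > 0" unfolding eq .
  hence "(- p) ^ 3 < 1 ^ 3" by simp
  hence p1: "-1 < p" using power_less_imp_less_base[of "- p" 3 1] by simp
  have p0: "p < 0" using b0 by (simp add: p_def)
  have "Q3.conjugate p = - (2 * (Q3.conjugate b)\<^sup>2)"
    unfolding p_def using b(1) by (simp add: Q3.conjugate_minus Q3.conjugate_mult Q3.conjugate_power)
  hence "Q3.conjugate p < 0" using b b0 by (simp add: Q3.conjugate_eq_0_iff)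
  thus False using cube_plus_one_Q3[OF p _ eq p1 p0] x by simp
qed

text \<open>
  If neither square is fixed by conjugation, the two products in \<open>conjugate_cases\<close> multiply to 9; but
  applied to the squares and to their conjugates, this bound makes the same product less than 1.
\<close>
lemma cube_sum_bound:
  fixes a b :: real
  assumes "a > 0" "b > 0" "a ^ 3 + b ^ 3 = 1"
  shows "0 < 1 / a - 1" "0 < 1 / b - 1" "(1 / a - 1) * (1 / b - 1) < 1"
proof -
  have "a ^ 3 > 0" "b ^ 3 > 0" using assms by simp_all
  hence "a ^ 3 < 1 ^ 3" "b ^ 3 < 1 ^ 3" unfolding power_one using assms(3) by linarith+
  hence ab: "a < 1" "b < 1" using power_less_imp_less_base[of a 3 1] power_less_imp_less_base[of b 3 1] by simp_all
  thus "0 < 1 / a - 1" "0 < 1 / b - 1" using assms by simp_all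
  have "a ^ 3 < a ^ 1" "b ^ 3 < b ^ 1"
    using ab assms power_strict_decreasing[of 1 3] by auto
  hence "a + b > 1" using assms by simp
  hence "(1 - a) * (1 - b) < a * b" by (simp add: algebra_simps)
  moreover have "(1 / a - 1) * (1 / b - 1) = (1 - a) * (1 - b) / (a * b)"
    using assms by (simp add: divide_simps)
  ultimately show "(1 / a - 1) * (1 / b - 1) < 1" using assms by simp
qed

lemma no_normalized_solution:
  assumes x: "x \<in> K.extension" "x \<noteq> 0" and y: "y \<in> K.extension" "y \<noteq> 0"
  shows "x ^ 6 + y ^ 6 \<noteq> 1"
proof
  assume eq: "x ^ 6 + y ^ 6 = 1"
  hence eq': "y ^ 6 + x ^ 6 = 1" by simp
  define x' y' where "x' = K.conjugate x" and "y' = K.conjugate y"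
  have sq: "K.conjugate (x\<^sup>2) = x'\<^sup>2" "K.conjugate (y\<^sup>2) = y'\<^sup>2"
    using x y by (simp_all add: K.conjugate_power x'_def y'_def)
  have nz: "x' \<noteq> 0" "y' \<noteq> 0"
    using x y by (simp_all add: K.conjugate_eq_0_iff x'_def y'_def)
  have "K.conjugate (x ^ 6 + y ^ 6) = K.conjugate 1" by (simp only: eq)
  hence ceq: "x' ^ 6 + y' ^ 6 = 1"
    using x y by (simp add: K.conjugate_add K.conjugate_power x'_def y'_def)
  have six: "t ^ 6 = (t\<^sup>2) ^ 3" for t :: real by (simp flip: power_mult)
  \<comment> \<open>Compares the equation with its conjugate; cubing is injective on the nonnegative
    squares.\<close>
  have fixed: "x'\<^sup>2 = x\<^sup>2 \<longleftrightarrow> y'\<^sup>2 = y\<^sup>2"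
    using eq ceq unfolding six by (smt (verit) power_eq_iff_eq_base zero_le_power2 zero_less_numeral)
  show False
  proof (cases "x'\<^sup>2 = x\<^sup>2")
    case True
    hence y2: "y'\<^sup>2 = y\<^sup>2" using fixed by blast
    have A: "K.conjugate ((y / x) ^ 3) = - ((y / x) ^ 3)"
      using conjugate_cases[OF x(1) y(1) x(2) eq] inverse_square_minus_one_neq[OF x] True
      unfolding sq by (auto simp: power2_eq_square)
    have "x' = x \<or> x' = - x" "y' = y \<or> y' = - y" using True y2 by (simp_all only: power2_eq_iff)
    moreover have "(y' / x') ^ 3 = - ((y / x) ^ 3)"
      using A x y by (simp add: K.conjugate_power K.conjugate_divide x'_def y'_def)
    moreover have "(y / x) ^ 3 \<noteq> - ((y / x) ^ 3)" using x y by simp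
    \<comment> \<open>As \<open>y / x\<close> changes sign under conjugation, exactly one of
      \<open>x\<close> and \<open>y\<close> does.\<close>
    ultimately have "x' = x \<and> y' = - y \<or> x' = - x \<and> y' = y" by auto
    thus False
      using no_solution_fixed_negated[OF x(1) y(1) x(2) y(2) eq]
        no_solution_fixed_negated[OF y(1) x(1) y(2) x(2) eq']
      unfolding x'_def y'_def by blast
  next
    case False
    hence "y'\<^sup>2 \<noteq> y\<^sup>2" using fixed by blast
    hence *: "(1 / x\<^sup>2 - 1) * (1 / x'\<^sup>2 - 1) = 3" "(1 / y\<^sup>2 - 1) * (1 / y'\<^sup>2 - 1) = 3"
      using conjugate_cases[OF x(1) y(1) x(2) eq] conjugate_cases[OF y(1) x(1) y(2) eq'] False
      unfolding sq by blast+
    have b: "0 < 1 / x\<^sup>2 - 1" "0 < 1 / y\<^sup>2 - 1" "(1 / x\<^sup>2 - 1) * (1 / y\<^sup>2 - 1) < 1"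
      using cube_sum_bound[of "x\<^sup>2" "y\<^sup>2"] x y eq unfolding six by simp_all
    have b': "0 < 1 / x'\<^sup>2 - 1" "0 < 1 / y'\<^sup>2 - 1" "(1 / x'\<^sup>2 - 1) * (1 / y'\<^sup>2 - 1) < 1"
      using cube_sum_bound[of "x'\<^sup>2" "y'\<^sup>2"] nz ceq unfolding six by simp_all
    have "9 = ((1 / x\<^sup>2 - 1) * (1 / x'\<^sup>2 - 1)) * ((1 / y\<^sup>2 - 1) * (1 / y'\<^sup>2 - 1))"
      unfolding * by simp
    also have "\<dots> = ((1 / x\<^sup>2 - 1) * (1 / y\<^sup>2 - 1)) * ((1 / x'\<^sup>2 - 1) * (1 / y'\<^sup>2 - 1))"
      by (simp only: ac_simps)
    also have "\<dots> < 1 * 1"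
      using b b' by (intro mult_strict_mono) simp_all
    finally show False by simp
  qed
qed

theorem theorem5p3:
  shows "\<not> (\<exists>x\<in>Q_sqrt2_sqrt3. \<exists>y\<in>Q_sqrt2_sqrt3. \<exists>z\<in>Q_sqrt2_sqrt3.
            x * y * z \<noteq> 0 \<and> x ^ 6 + y ^ 6 = z ^ 6)"
proof
  assume "\<exists>x\<in>Q_sqrt2_sqrt3. \<exists>y\<in>Q_sqrt2_sqrt3. \<exists>z\<in>Q_sqrt2_sqrt3.
            x * y * z \<noteq> 0 \<and> x ^ 6 + y ^ 6 = z ^ 6"
  then obtain x y z where *: "x \<in> K.extension" "y \<in> K.extension" "z \<in> K.extension"
    "x \<noteq> 0" "y \<noteq> 0" "z \<noteq> 0" and eq: "x ^ 6 + y ^ 6 = z ^ 6"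
    using Q_sqrt2_sqrt3_subset by auto
  have "(x / z) ^ 6 + (y / z) ^ 6 = 1"
    using eq * by (simp add: power_divide flip: add_divide_distrib)
  thus False using no_normalized_solution[of "x / z" "y / z"] * by simp
qed

end
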